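(* Let $V$ be a simple Euclidean Jordan algebra of rank $r$ with product $\circ$, unit element $e$ and Jordan trace $\tau$, equipped with the trace inner product $\langle x,y\rangle_J:=\tau(x\circ y)$ and associated norm $\|\cdot\|_J$, and let $K\subset V$ be the cone of squares. Let $E_K$ be the set of $u\in V$ with $\|u\|_J=1$ such that $\mathbb{R}_+u$ is an extreme ray of $K$. Then: (i) $E_K$ is the set of primitive idempotents of $V$. (ii) $E_K\subset\{x\in V:\tau(x)=1\}$, hence $0\notin\operatorname{aff}(E_K)$ (equivalently, as $V$ is finite-dimensional, $0\notin\operatorname{cl}\operatorname{aff}(E_K)$). (iii) Let $d:=-P_{\operatorname{cl}\operatorname{aff}(E_K)}(0)$, where $P$ is the orthogonal projection with respect to $\langle\cdot,\cdot\rangle_J$. Then $d=-e/r$ and $\|d\|_J^2=1/r$.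
   Context: A Euclidean Jordan algebra is a finite-dimensional real commutative algebra $(V,\circ)$ with unit satisfying the Jordan identity $x\circ(x^2\circ y)=x^2\circ(x\circ y)$ and admitting an inner product for which multiplication operators are self-adjoint; it is simple if it has no nontrivial ideals. The cone of squares is $K=\{x\circ x:x\in V\}$. An idempotent $c$ satisfies $c\circ c=c$; it is primitive if it is nonzero and not a sum of two nonzero idempotents. The rank $r$ is the common number of elements of any Jordan frame (a complete system of mutually orthogonal primitive idempotents summing to $e$). The Jordan trace is $\tau(x)=\sum_{i=1}^r\lambda_i$ for a spectral decomposition $x=\sum_{i=1}^r\lambda_ic_i$ along a Jordan frame $\{c_1,\ldots,c_r\}$. $\operatorname{aff}$ denotes affine hull and $\operatorname{cl}$ closure. *)

theory Defs
  imports "HOL-Analysis.Analysis"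
begin

text \<open>
  The underlying space is a type of class \<open>euclidean_space\<close>.  This class supplies finite
  dimension, dimension at least one, and the topology; its own inner product is not used and is
  unrelated to the Jordan product.  All metric notions below (inner product, norm, projection) come
  from the Jordan trace.  For \<open>closure\<close> there is no difference, since all norms of a
  finite-dimensional space induce the same topology.
\<close>

definition is_inner_product :: "('a::real_vector \<Rightarrow> 'a \<Rightarrow> real) \<Rightarrow> bool" where
  "is_inner_product B \<longleftrightarrow>
     bilinear B \<and> (\<forall>x y. B x y = B y x) \<and> (\<forall>x. x \<noteq> 0 \<longrightarrow> B x x > 0)"

definition euclidean_jordan_algebra :: "('a::euclidean_space \<Rightarrow> 'a \<Rightarrow> 'a) \<Rightarrow> 'a \<Rightarrow> bool" where
  "euclidean_jordan_algebra jm e \<longleftrightarrow>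
     bilinear jm \<and>
     (\<forall>x y. jm x y = jm y x) \<and>
     (\<forall>x. jm e x = x) \<and>
     (\<forall>x y. jm x (jm (jm x x) y) = jm (jm x x) (jm x y)) \<and>
     (\<exists>B. is_inner_product B \<and> (\<forall>x y z. B (jm x y) z = B y (jm x z)))"

definition jordan_ideal :: "('a::real_vector \<Rightarrow> 'a \<Rightarrow> 'a) \<Rightarrow> 'a set \<Rightarrow> bool" where
  "jordan_ideal jm I \<longleftrightarrow> subspace I \<and> (\<forall>x. \<forall>y\<in>I. jm x y \<in> I)"

definition simple_euclidean_jordan_algebra ::
    "('a::euclidean_space \<Rightarrow> 'a \<Rightarrow> 'a) \<Rightarrow> 'a \<Rightarrow> bool" where
  "simple_euclidean_jordan_algebra jm e \<longleftrightarrow>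
     euclidean_jordan_algebra jm e \<and> (\<forall>I. jordan_ideal jm I \<longrightarrow> I = {0} \<or> I = UNIV)"

definition cone_of_squares :: "('a \<Rightarrow> 'a \<Rightarrow> 'a) \<Rightarrow> 'a set" where
  "cone_of_squares jm = {jm x x | x. True}"

definition idempotent_elem :: "('a \<Rightarrow> 'a \<Rightarrow> 'a) \<Rightarrow> 'a \<Rightarrow> bool" where
  "idempotent_elem jm c \<longleftrightarrow> jm c c = c"

definition primitive_idempotent :: "('a::real_vector \<Rightarrow> 'a \<Rightarrow> 'a) \<Rightarrow> 'a \<Rightarrow> bool" where
  "primitive_idempotent jm c \<longleftrightarrow>
     idempotent_elem jm c \<and> c \<noteq> 0 \<and>
     \<not> (\<exists>a b. idempotent_elem jm a \<and> a \<noteq> 0 \<and> idempotent_elem jm b \<and> b \<noteq> 0 \<and> c = a + b)"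

definition jordan_frame :: "('a::real_vector \<Rightarrow> 'a \<Rightarrow> 'a) \<Rightarrow> 'a \<Rightarrow> 'a set \<Rightarrow> bool" where
  "jordan_frame jm e C \<longleftrightarrow>
     finite C \<and>
     (\<forall>c\<in>C. primitive_idempotent jm c) \<and>
     (\<forall>c\<in>C. \<forall>c'\<in>C. c \<noteq> c' \<longrightarrow> jm c c' = 0) \<and>
     \<Sum>C = e"

text \<open>
  In a Euclidean Jordan algebra every element has a spectral decomposition, and neither the number
  of elements of a Jordan frame nor the sum of the eigenvalues depends on the choices, so the
  descriptions below single out one value.
\<close>

definition jordan_rank :: "('a::real_vector \<Rightarrow> 'a \<Rightarrow> 'a) \<Rightarrow> 'a \<Rightarrow> nat" where
  "jordan_rank jm e = (THE r. \<exists>C. jordan_frame jm e C \<and> r = card C)"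

definition jordan_trace :: "('a::real_vector \<Rightarrow> 'a \<Rightarrow> 'a) \<Rightarrow> 'a \<Rightarrow> 'a \<Rightarrow> real" where
  "jordan_trace jm e x =
     (THE t. \<exists>C l. jordan_frame jm e C \<and> x = (\<Sum>c\<in>C. l c *\<^sub>R c) \<and> t = (\<Sum>c\<in>C. l c))"

definition trace_inner :: "('a::real_vector \<Rightarrow> 'a \<Rightarrow> 'a) \<Rightarrow> 'a \<Rightarrow> 'a \<Rightarrow> 'a \<Rightarrow> real" where
  "trace_inner jm e x y = jordan_trace jm e (jm x y)"

definition trace_norm :: "('a::real_vector \<Rightarrow> 'a \<Rightarrow> 'a) \<Rightarrow> 'a \<Rightarrow> 'a \<Rightarrow> real" where
  "trace_norm jm e x = sqrt (trace_inner jm e x x)"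

definition trace_proj :: "('a::real_vector \<Rightarrow> 'a \<Rightarrow> 'a) \<Rightarrow> 'a \<Rightarrow> 'a set \<Rightarrow> 'a \<Rightarrow> 'a" where
  "trace_proj jm e S x =
     (THE y. y \<in> S \<and> (\<forall>z\<in>S. trace_norm jm e (x - y) \<le> trace_norm jm e (x - z)))"

definition ray :: "'a::real_vector \<Rightarrow> 'a set" where
  "ray u = {t *\<^sub>R u | t. 0 \<le> t}"

definition extreme_ray_of :: "'a::real_vector set \<Rightarrow> 'a set \<Rightarrow> bool" (infixr "extreme'_ray'_of" 50)
  where "R extreme_ray_of K \<longleftrightarrow> (\<exists>u. u \<noteq> 0 \<and> R = ray u) \<and> R face_of K"

definition unit_extreme_generators :: "('a::real_vector \<Rightarrow> 'a \<Rightarrow> 'a) \<Rightarrow> 'a \<Rightarrow> 'a set" where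
  "unit_extreme_generators jm e =
     {u. trace_norm jm e u = 1 \<and> ray u extreme_ray_of cone_of_squares jm}"

end

theory Submission imports Defs begin

text \<open>
  The point is that the Jordan trace is linear.  Let \<open>B\<close> be an inner product with self-adjoint
  multiplications.  Two primitive idempotents that are not \<open>B\<close>-orthogonal have the same \<open>B\<close>-norm,
  because the quadratic map of a primitive idempotent has rank one.  Hence the primitive idempotents
  of a fixed \<open>B\<close>-norm span an ideal, and by simplicity all primitive idempotents have the same
  \<open>B\<close>-norm; after rescaling it is 1, and then \<open>\<tau>(x) = B x e\<close> and the trace inner product is \<open>B\<close>.
  An element \<open>a\<close> of \<open>K\<close> with \<open>B a (e - c) = 0\<close> for a primitive idempotent \<open>c\<close> is a
  multiple of \<open>c\<close>, which gives the extreme rays.  Finally \<open>e / r\<close> is the barycentre of a Jordan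
  frame and is orthogonal to the direction \<open>\<tau> = 0\<close> of the hyperplane \<open>\<tau> = 1\<close>.
\<close>

section \<open>Associative subalgebras of Euclidean Jordan algebras\<close>

text \<open>\<open>B\<close> is a parameter because the definition only asserts that some suitable
  form exists. It stays arbitrary here and is rescaled once all primitive idempotents are known to
  have the same norm.\<close>

locale euclidean_jordan =
  fixes jm :: "'a::euclidean_space \<Rightarrow> 'a \<Rightarrow> 'a" (infixl "\<odot>" 70)
    and e :: 'a and B :: "'a \<Rightarrow> 'a \<Rightarrow> real"
  assumes bilinear_jm: "bilinear jm"
    and commute: "x \<odot> y = y \<odot> x"
    and unit_left [simp]: "e \<odot> x = x"
    and jordan_identity: "x \<odot> ((x \<odot> x) \<odot> y) = (x \<odot> x) \<odot> (x \<odot> y)"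
    and inner_product: "is_inner_product B"
    and self_adjoint: "B (x \<odot> y) z = B y (x \<odot> z)"
begin

section \<open>Bilinear arithmetic and the linearized Jordan identity\<close>

lemmas jm_simps = bilinear_ladd[OF bilinear_jm] bilinear_radd[OF bilinear_jm]
  bilinear_lmul[OF bilinear_jm] bilinear_rmul[OF bilinear_jm]
  bilinear_lneg[OF bilinear_jm] bilinear_rneg[OF bilinear_jm]
  bilinear_lsub[OF bilinear_jm] bilinear_rsub[OF bilinear_jm]
  bilinear_lzero[OF bilinear_jm] bilinear_rzero[OF bilinear_jm]

lemma bilinear_B: "bilinear B"
  using inner_product by (simp add: is_inner_product_def)

lemmas B_simps = bilinear_ladd[OF bilinear_B] bilinear_radd[OF bilinear_B]
  bilinear_lmul[OF bilinear_B] bilinear_rmul[OF bilinear_B]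
  bilinear_lneg[OF bilinear_B] bilinear_rneg[OF bilinear_B]
  bilinear_lsub[OF bilinear_B] bilinear_rsub[OF bilinear_B]
  bilinear_lzero[OF bilinear_B] bilinear_rzero[OF bilinear_B]

lemma B_sym: "B x y = B y x"
  using inner_product by (simp add: is_inner_product_def)

lemma B_pos: "x \<noteq> 0 \<Longrightarrow> B x x > 0"
  using inner_product by (simp add: is_inner_product_def)

lemma B_nonneg: "B x x \<ge> 0"
  using B_pos[of x] by (cases "x = 0") (auto simp: B_simps)

lemma B_eq_0 [simp]: "B x x = 0 \<longleftrightarrow> x = 0"
  using B_pos[of x] by (cases "x = 0") (auto simp: B_simps)

lemma unit_right [simp]: "x \<odot> e = x"
  using commute[of x e] by simp

lemma linear_jm: "linear ((\<odot>) x)"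
  using bilinear_jm by (simp add: bilinear_def)

lemma linear_B: "linear (B x)"
  using bilinear_B by (simp add: bilinear_def)

lemma jm_sum_right: "x \<odot> (\<Sum>i\<in>A. f i) = (\<Sum>i\<in>A. x \<odot> f i)"
  by (rule linear_sum[OF linear_jm])

lemma jm_sum_left: "(\<Sum>i\<in>A. f i) \<odot> x = (\<Sum>i\<in>A. f i \<odot> x)"
  by (simp add: commute[of _ x] jm_sum_right)

lemma B_sum_right: "B x (\<Sum>i\<in>A. f i) = (\<Sum>i\<in>A. B x (f i))"
  by (rule linear_sum[OF linear_B])

lemma B_sum_left: "B (\<Sum>i\<in>A. f i) x = (\<Sum>i\<in>A. B (f i) x)"
  by (simp add: B_sym[of _ x] B_sum_right)

text \<open>The part of the Jordan identity for \<open>x + z\<close> that is linear in \<open>z\<close>, isolated by comparing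
  \<open>x + z\<close> with \<open>x - z\<close>.\<close>

lemma jordan_linearized:
  "(x \<odot> x \<odot> y) \<odot> z = 2 *\<^sub>R ((x \<odot> y) \<odot> (x \<odot> z)) + (x \<odot> x) \<odot> (y \<odot> z) - 2 *\<^sub>R (x \<odot> (y \<odot> (x \<odot> z)))"
proof -
  have c: "z \<odot> x = x \<odot> z" "(x \<odot> x \<odot> y) \<odot> z = z \<odot> (x \<odot> x \<odot> y)" "y \<odot> z = z \<odot> y" "y \<odot> (x \<odot> z) = x \<odot> z \<odot> y"
    "x \<odot> y \<odot> (x \<odot> z) = x \<odot> z \<odot> (x \<odot> y)"
    by (rule commute)+
  \<comment> \<open>The difference of \<open>p\<close> and \<open>m\<close> keeps the parts odd in
    \<open>z\<close>, and \<open>q\<close> removes the cubic one. Testing against every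
    \<open>v\<close> turns this into real arithmetic.\<close>
  note p = jordan_identity[of "x + z" y] and m = jordan_identity[of "x - z" y] and q = jordan_identity[of z y]
  have "v \<bullet> ((x \<odot> x \<odot> y) \<odot> z) = v \<bullet> (2 *\<^sub>R ((x \<odot> y) \<odot> (x \<odot> z)) + (x \<odot> x) \<odot> (y \<odot> z) - 2 *\<^sub>R (x \<odot> (y \<odot> (x \<odot> z))))" for v
    unfolding c
    using arg_cong[OF p, of "(\<bullet>) v"] arg_cong[OF m, of "(\<bullet>) v"] arg_cong[OF q, of "(\<bullet>) v"]
    by (simp add: c(1) jm_simps inner_add_right inner_diff_right)
  then show ?thesis
    using vector_eq_rdot by (metis inner_commute)
qed

text \<open>Putting \<open>c\<close> for both \<open>x\<close> and \<open>y\<close> in the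
  linearized identity yields \<open>2 t^3 - 3 t^2 + t = 0\<close> for multiplication by
  \<open>c\<close>; the roots 0, 1/2, 1 are the Peirce eigenvalues.\<close>

lemma peirce_polynomial:
  assumes "c \<odot> c = c"
  shows "c \<odot> z = 3 *\<^sub>R (c \<odot> (c \<odot> z)) - 2 *\<^sub>R (c \<odot> (c \<odot> (c \<odot> z)))"
  using jordan_linearized[of c c z] by (simp add: assms scaleR_left_distrib[of 2 1, simplified])

text \<open>The subalgebra generated by \<open>x\<close>: the linearized identity writes multiplication by
  \<open>x ^ (n + 2)\<close> in terms of multiplications by \<open>x\<close>, \<open>x\<^sup>2\<close> and lower powers, so all of these commute.\<close>

lemma exists_associative_subalgebra:
  obtains W where "subspace W" "e \<in> W" "x \<in> W"
    "\<And>a b. a \<in> W \<Longrightarrow> b \<in> W \<Longrightarrow> a \<odot> b \<in> W"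
    "\<And>a b y. a \<in> W \<Longrightarrow> b \<in> W \<Longrightarrow> a \<odot> (b \<odot> y) = b \<odot> (a \<odot> y)"
proof -
  define pw where "pw n = (((\<odot>) x) ^^ n) e" for n
  have pw0: "pw 0 = e" and pwS: "pw (Suc n) = x \<odot> pw n" for n
    by (simp_all add: pw_def)
  have sq: "(x \<odot> x) \<odot> pw n = pw (Suc (Suc n))" for n
    by (induction n) (simp_all add: pw0 pwS flip: jordan_identity)
  have step: "pw (Suc (Suc n)) \<odot> z = 2 *\<^sub>R (pw (Suc n) \<odot> (x \<odot> z)) + (x \<odot> x) \<odot> (pw n \<odot> z)
      - 2 *\<^sub>R (x \<odot> (pw n \<odot> (x \<odot> z)))" for n z
    using jordan_linearized[of x "pw n" z] by (simp add: sq pwS)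
  have gen: "M (pw n \<odot> y) = pw n \<odot> M y"
    if M: "linear M" "\<And>y. M (x \<odot> y) = x \<odot> M y" "\<And>y. M ((x \<odot> x) \<odot> y) = (x \<odot> x) \<odot> M y" for M n y
  proof -
    \<comment> \<open>\<open>step\<close> reaches back two powers, so the induction carries two
      consecutive ones.\<close>
    have "(\<forall>y. M (pw n \<odot> y) = pw n \<odot> M y) \<and> (\<forall>y. M (pw (Suc n) \<odot> y) = pw (Suc n) \<odot> M y)"
    proof (induction n)
      case 0
      then show ?case by (simp add: pw0 pwS M)
    next
      case (Suc n)
      then show ?case
        by (simp add: step linear_add[OF M(1)] linear_diff[OF M(1)] linear_cmul[OF M(1)] M(2,3))
    qed
    then show ?thesis by blast
  qed
  have c1: "x \<odot> (pw n \<odot> y) = pw n \<odot> (x \<odot> y)" for n y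
    by (rule gen[OF linear_jm]) (simp_all add: jordan_identity)
  have c2: "(x \<odot> x) \<odot> (pw n \<odot> y) = pw n \<odot> ((x \<odot> x) \<odot> y)" for n y
    by (rule gen[OF linear_jm]) (simp_all add: jordan_identity)
  \<comment> \<open>\<open>c1\<close> and \<open>c2\<close> are the hypotheses of \<open>gen\<close>
    when \<open>M\<close> is multiplication by \<open>pw m\<close>.\<close>
  have cc: "pw m \<odot> (pw n \<odot> y) = pw n \<odot> (pw m \<odot> y)" for m n y
    by (rule gen[OF linear_jm]) (simp_all add: c1 c2)
  have add: "pw m \<odot> pw n = pw (m + n)" for m n
    by (induction n) (simp_all add: pw0 pwS flip: c1)
  let ?W = "span (range pw)"
  have W1: "a \<odot> (pw n \<odot> y) = pw n \<odot> (a \<odot> y)" if "a \<in> ?W" for a n y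
    using that
  proof (induction a rule: span_induct)
    case base
    show ?case by (auto simp: subspace_def jm_simps)
  next
    case (step a)
    then show ?case using cc by auto
  qed
  have W2: "a \<odot> (b \<odot> y) = b \<odot> (a \<odot> y)" if "a \<in> ?W" "b \<in> ?W" for a b y
    using that(2)
  proof (induction b rule: span_induct)
    case base
    show ?case by (auto simp: subspace_def jm_simps)
  next
    case (step b)
    then show ?case using W1[OF that(1)] by auto
  qed
  have W3: "a \<odot> pw n \<in> ?W" if "a \<in> ?W" for a n
    using that
  proof (induction a rule: span_induct)
    case base
    show ?case by (auto simp: subspace_def jm_simps intro: span_zero span_add span_scale)
  next
    case (step a)
    then show ?case using add by (auto intro: span_base)
  qed
  have W4: "a \<odot> b \<in> ?W" if "a \<in> ?W" "b \<in> ?W" for a b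
    using that(2)
  proof (induction b rule: span_induct)
    case base
    show ?case by (auto simp: subspace_def jm_simps intro: span_zero span_add span_scale)
  next
    case (step b)
    then show ?case using W3[OF that(1)] by auto
  qed
  have "pw 0 \<in> ?W" "pw 1 \<in> ?W"
    by (auto intro: span_base)
  then show thesis
    using that[of ?W] W2 W4 by (simp add: pw0 pwS)
qed

section \<open>Projections and eigenvectors with respect to \<open>B\<close>\<close>

lemma exists_B_projection:
  assumes "subspace S"
  obtains p where "p \<in> S" "\<And>s. s \<in> S \<Longrightarrow> B (x - p) s = 0"
proof -
  \<comment> \<open>Gram-Schmidt for \<open>B\<close>: a new vector \<open>a\<close> is replaced by
    its component \<open>a'\<close> orthogonal to the span so far.\<close>
  have *: "\<exists>p\<in>span F. \<forall>s\<in>span F. B (x - p) s = 0" if "finite F" for F x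
    using that
  proof (induction F arbitrary: x)
    case empty
    then show ?case by (simp add: B_simps)
  next
    case (insert a F)
    obtain q where q: "q \<in> span F" "\<And>s. s \<in> span F \<Longrightarrow> B (a - q) s = 0"
      using insert.IH[of a] by blast
    obtain p where p: "p \<in> span F" "\<And>s. s \<in> span F \<Longrightarrow> B (x - p) s = 0"
      using insert.IH[of x] by blast
    define a' where "a' = a - q"
    \<comment> \<open>If \<open>a' = 0\<close> then \<open>t = 0\<close> as well, because of division by zero.\<close>
    define t where "t = B (x - p) a' / B a' a'"
    have sub: "span F \<subseteq> span (insert a F)"
      by (rule span_mono) auto
    have "a' \<in> span (insert a F)"
      unfolding a'_def using q(1) sub by (auto intro!: span_diff intro: span_base)
    then have in': "p + t *\<^sub>R a' \<in> span (insert a F)"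
      using p(1) sub by (auto intro!: span_add span_scale)
    have t: "B (x - p) a' = t * B a' a'"
      by (cases "a' = 0") (simp_all add: t_def B_simps)
    have "B (x - (p + t *\<^sub>R a')) s = 0" if "s \<in> span (insert a F)" for s
    proof -
      obtain k where k: "s - k *\<^sub>R a \<in> span F"
        using \<open>s \<in> span (insert a F)\<close> span_breakdown_eq by blast
      define w where "w = s - k *\<^sub>R a + k *\<^sub>R q"
      have w: "w \<in> span F" unfolding w_def using k q(1) by (auto intro!: span_add span_scale)
      have s: "s = w + k *\<^sub>R a'" by (simp add: w_def a'_def algebra_simps)
      have "B (x - p) w = 0" "B a' w = 0"
        using p(2) q(2) w by (auto simp: a'_def)
      then show ?thesis using t unfolding s by (simp add: B_simps algebra_simps)
    qed
    then show ?case using in' by blast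
  qed
  obtain F where "finite F" "span F = S"
    using basis_exists[of S] assms independent_imp_finite span_subspace by metis
  with *[of F x] show thesis using that by blast
qed

text \<open>The maximizer of the Rayleigh quotient is an eigenvector.\<close>

lemma exists_eigenvector:
  assumes U: "subspace U" "U \<noteq> {0}" and inv: "\<And>w. w \<in> U \<Longrightarrow> x \<odot> w \<in> U"
  obtains \<mu> w where "w \<in> U" "w \<noteq> 0" "x \<odot> w = \<mu> *\<^sub>R w"
proof -
  define f where "f w = B (x \<odot> w) w / B w w" for w
  \<comment> \<open>\<open>f\<close> is homogeneous of degree 0, so its maximum over this compact
    set is its maximum over all nonzero vectors of \<open>U\<close>.\<close>
  let ?S = "U \<inter> sphere 0 1"
  obtain u where u: "u \<in> U" "u \<noteq> 0" using U subspace_0 by blast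
  have "(1 / norm u) *\<^sub>R u \<in> ?S" using u U by (auto intro: subspace_scale)
  then have ne: "?S \<noteq> {}" by blast
  have comp: "compact ?S" using U by (simp add: closed_Int_compact closed_subspace)
  have cj: "continuous_on ?S (\<lambda>w. x \<odot> w)"
    using linear_continuous_on linear_conv_bounded_linear linear_jm by blast
  have cB: "continuous_on ?S (\<lambda>w. B (g w) (h w))" if "continuous_on ?S g" "continuous_on ?S h" for g h
    using bounded_bilinear.continuous_on[OF bilinear_conv_bounded_bilinear[THEN iffD1, OF bilinear_B]] that by blast
  have "continuous_on ?S f"
    unfolding f_def by (intro continuous_on_divide cB cj continuous_on_id) auto
  then obtain w where w: "w \<in> ?S" "\<And>v. v \<in> ?S \<Longrightarrow> f v \<le> f w"
    using continuous_attains_sup[OF comp ne] by blast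
  define \<mu> where "\<mu> = f w"
  have w0: "w \<noteq> 0" and wU: "w \<in> U" using w by auto
  \<comment> \<open>\<open>Q\<close> is the form of \<mu> minus multiplication by \<open>x\<close>.
    It is nonnegative on \<open>U\<close> and zero at \<open>w\<close>, so its first variation at
    \<open>w\<close> must vanish.\<close>
  define Q where "Q a b = \<mu> * B a b - B (x \<odot> a) b" for a b
  have Qsym: "Q a b = Q b a" for a b
    unfolding Q_def by (metis B_sym self_adjoint)
  have Qw: "Q w w = 0" using w0 by (simp add: Q_def \<mu>_def f_def)
  have Qpos: "Q v v \<ge> 0" if "v \<in> U" for v
  proof (cases "v = 0")
    case False
    have "(1 / norm v) *\<^sub>R v \<in> ?S" using that False U by (auto intro: subspace_scale)
    then have "f ((1 / norm v) *\<^sub>R v) \<le> \<mu>" using w by (simp add: \<mu>_def)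
    also have "f ((1 / norm v) *\<^sub>R v) = f v" using False by (simp add: f_def jm_simps B_simps)
    finally show ?thesis using B_pos[OF False] by (simp add: Q_def f_def divide_simps)
  qed (simp add: Q_def B_simps)
  have Q0: "Q w v = 0" if v: "v \<in> U" for v
  proof -
    have *: "0 \<le> 2 * t * Q w v + t\<^sup>2 * Q v v" for t
    proof -
      have "0 \<le> Q (w + t *\<^sub>R v) (w + t *\<^sub>R v)"
        using U v wU by (intro Qpos) (auto intro: subspace_add subspace_scale)
      also have "\<dots> = Q w w + t * (Q w v + Q v w) + t\<^sup>2 * Q v v"
        by (simp add: Q_def B_simps jm_simps algebra_simps power2_eq_square)
      finally show ?thesis by (simp add: Qw Qsym[of v w])
    qed
    \<comment> \<open>The optimal \<open>t\<close> would be \<open>- Q w v / Q v v\<close>, but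
      \<open>Q v v\<close> may be 0. Adding 1 keeps the denominator positive, and the value is still
      negative unless \<open>Q w v = 0\<close>.\<close>
    define k where "k = Q v v + 1"
    have k: "k > 0" "Q v v = k - 1" using Qpos[OF v] by (simp_all add: k_def)
    have "0 \<le> 2 * (- Q w v / k) * Q w v + (- Q w v / k)\<^sup>2 * (k - 1)"
      using *[of "- Q w v / k"] k by simp
    also have "\<dots> = - (Q w v)\<^sup>2 * (k + 1) / k\<^sup>2"
      using k by (simp add: field_simps power2_eq_square)
    finally have "(Q w v)\<^sup>2 * (k + 1) \<le> 0" using k by (simp add: field_simps)
    then show ?thesis using k by (simp add: mult_le_0_iff)
  qed
  define v where "v = \<mu> *\<^sub>R w - x \<odot> w"
  have "v \<in> U" using U wU inv by (auto simp: v_def intro: subspace_diff subspace_scale)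
  then have "B v v = 0" using Q0[of v] by (simp add: Q_def v_def B_simps B_sym[of w "x \<odot> w"])
  then have "x \<odot> w = \<mu> *\<^sub>R w" by (simp add: v_def)
  then show thesis using that w0 wU by blast
qed


section \<open>Idempotents and the spectral decomposition\<close>

text \<open>A precursor of Jordan frames: sum \<open>e\<close> and primitivity are obtained later,
  each by a maximality argument.\<close>

definition idempotent_system :: "'a set \<Rightarrow> bool" where
  "idempotent_system C \<longleftrightarrow> finite C \<and> (\<forall>c\<in>C. c \<odot> c = c \<and> c \<noteq> 0) \<and>
     (\<forall>c\<in>C. \<forall>d\<in>C. c \<noteq> d \<longrightarrow> c \<odot> d = 0)"

lemma idempotent_system_jm:
  assumes "idempotent_system C" "c \<in> C"
  shows "c \<odot> (\<Sum>i\<in>C. l i *\<^sub>R i) = l c *\<^sub>R c"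
proof -
  have "c \<odot> (\<Sum>i\<in>C. l i *\<^sub>R i) = (\<Sum>i\<in>C. if i = c then l c *\<^sub>R c else 0)"
    unfolding jm_sum_right using assms
    by (intro sum.cong) (auto simp: idempotent_system_def jm_simps)
  then show ?thesis
    using assms by (simp add: idempotent_system_def)
qed

lemma idempotent_system_mult:
  assumes "idempotent_system C"
  shows "(\<Sum>i\<in>C. l i *\<^sub>R i) \<odot> (\<Sum>i\<in>C. m i *\<^sub>R i) = (\<Sum>i\<in>C. (l i * m i) *\<^sub>R i)"
  unfolding jm_sum_left by (intro sum.cong refl) (simp add: jm_simps idempotent_system_jm[OF assms])

lemma idempotent_system_B:
  assumes "idempotent_system C" "c \<in> C"
  shows "B (\<Sum>i\<in>C. l i *\<^sub>R i) c = l c * B c c"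
proof -
  have "B (\<Sum>i\<in>C. l i *\<^sub>R i) c = B (c \<odot> (\<Sum>i\<in>C. l i *\<^sub>R i)) c"
    using assms by (simp add: self_adjoint idempotent_system_def)
  then show ?thesis
    by (simp add: idempotent_system_jm[OF assms] B_simps)
qed

text \<open>Multiplying a linear relation by a member isolates its coefficient. The resulting bound
  is what makes systems of maximal size exist.\<close>

lemma idempotent_system_card:
  assumes C: "idempotent_system C"
  shows "card C \<le> DIM('a)"
proof -
  have "independent C"
  proof
    assume "dependent C"
    then obtain u v where v: "v \<in> C" "u v \<noteq> 0" and s: "(\<Sum>v\<in>C. u v *\<^sub>R v) = 0"
      using C dependent_finite[of C] by (auto simp: idempotent_system_def)
    have "u v *\<^sub>R v = 0"
      using idempotent_system_jm[OF C v(1), of u] s by (simp add: jm_simps)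
    then show False using v C by (auto simp: idempotent_system_def)
  qed
  then show ?thesis using independent_bound by blast
qed

lemma exists_maximal_idempotent_system:
  assumes "P C\<^sub>0" "idempotent_system C\<^sub>0"
  obtains C where "P C" "idempotent_system C"
    "\<And>D. P D \<Longrightarrow> idempotent_system D \<Longrightarrow> card D \<le> card C"
proof -
  have "\<exists>C. (P C \<and> idempotent_system C) \<and> (\<forall>D. P D \<and> idempotent_system D \<longrightarrow> card D \<le> card C)"
    by (rule ex_has_greatest_nat[where b = "Suc DIM('a)" and k = C\<^sub>0])
      (use assms idempotent_system_card in \<open>auto simp: less_Suc_eq_le\<close>)
  then show thesis using that by blast
qed

text \<open>Take a largest system in \<open>W\<close> of idempotents that are eigenvectors of
  \<open>x\<close>. If the remainder \<open>s\<close> were nonzero, an eigenvector in the part of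
  \<open>W\<close> fixed by \<open>s\<close> would lead to one more such idempotent.\<close>

lemma exists_idempotent_eigensystem:
  obtains C where "idempotent_system C" "\<Sum>C = e" "x \<in> span C"
proof -
  obtain W where W: "subspace W" "e \<in> W" "x \<in> W"
    and closed: "\<And>a b. a \<in> W \<Longrightarrow> b \<in> W \<Longrightarrow> a \<odot> b \<in> W"
    and comm: "\<And>a b y. a \<in> W \<Longrightarrow> b \<in> W \<Longrightarrow> a \<odot> (b \<odot> y) = b \<odot> (a \<odot> y)"
    using exists_associative_subalgebra[of x] by metis
  define P where "P C \<longleftrightarrow> C \<subseteq> W \<and> (\<forall>c\<in>C. \<exists>\<mu>. x \<odot> c = \<mu> *\<^sub>R c)" for C
  have "P {}" "idempotent_system {}" by (auto simp: P_def idempotent_system_def)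
  then obtain C where PC: "P C" and C: "idempotent_system C"
    and max: "\<And>D. P D \<Longrightarrow> idempotent_system D \<Longrightarrow> card D \<le> card C"
    using exists_maximal_idempotent_system by metis
  have CW: "C \<subseteq> W" and finC: "finite C" using PC C by (auto simp: P_def idempotent_system_def)
  define s where "s = e - \<Sum>C"
  have sumC: "c \<odot> \<Sum>C = c" if "c \<in> C" for c
    using idempotent_system_jm[OF C that, of "\<lambda>_. 1"] by simp
  have sc: "s \<odot> c = 0" if "c \<in> C" for c
    using sumC[OF that] by (simp add: s_def jm_simps commute[of _ c])
  have sW: "s \<in> W" unfolding s_def using W CW by (auto intro!: subspace_diff subspace_sum)
  have "s \<odot> s = s \<odot> e - (\<Sum>c\<in>C. s \<odot> c)" by (simp add: s_def jm_simps jm_sum_right)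
  then have ss: "s \<odot> s = s" by (simp add: sc)
  have "s = 0"
  proof (rule ccontr)
    assume s0: "s \<noteq> 0"
    define U where "U = {w \<in> W. s \<odot> w = w}"
    have "subspace U" "U \<noteq> {0}"
      using W s0 ss sW by (auto simp: U_def subspace_def jm_simps)
    moreover have "x \<odot> w \<in> U" if "w \<in> U" for w
      using that W closed comm[OF sW \<open>x \<in> W\<close>] by (auto simp: U_def)
    ultimately obtain \<mu> w where w: "w \<in> U" "w \<noteq> 0" "x \<odot> w = \<mu> *\<^sub>R w"
      using exists_eigenvector by metis
    \<comment> \<open>\<open>I\<close> is an ideal of \<open>W\<close>, so the \<open>B\<close>-projection of \<open>e\<close> to \<open>I\<close> is a unit of \<open>I\<close>.\<close>
    define I where "I = {w \<in> U. x \<odot> w = \<mu> *\<^sub>R w}"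
    have "subspace I" using \<open>subspace U\<close> by (auto simp: I_def subspace_def jm_simps algebra_simps)
    have ideal: "a \<odot> i \<in> I" if "a \<in> W" "i \<in> I" for a i
      using that closed[of a i] comm[OF sW that(1), of i] comm[OF \<open>x \<in> W\<close> that(1), of i]
      by (auto simp: I_def U_def jm_simps)
    obtain p where p: "p \<in> I" and pq: "\<And>i. i \<in> I \<Longrightarrow> B (e - p) i = 0"
      using exists_B_projection[OF \<open>subspace I\<close>, of e] by metis
    have pW: "p \<in> W" "s \<odot> p = p" "\<exists>\<mu>. x \<odot> p = \<mu> *\<^sub>R p" using p by (auto simp: I_def U_def)
    have pI: "p \<odot> i = i" if i: "i \<in> I" for i
    proof -
      have iW: "i \<in> W" using i by (simp add: I_def U_def)
      \<comment> \<open>Self-adjointness turns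
        \<open>B (e - p) (i \<odot> ((e - p) \<odot> i))\<close> into the squared norm of
        \<open>(e - p) \<odot> i\<close>.\<close>
      have "(e - p) \<odot> i \<in> I" using W pW i by (intro ideal) (auto intro: subspace_diff)
      then have "B (e - p) (i \<odot> ((e - p) \<odot> i)) = 0" using pq ideal iW by blast
      then have "B (i \<odot> (e - p)) ((e - p) \<odot> i) = 0" by (simp add: self_adjoint)
      then have "(e - p) \<odot> i = 0" by (simp add: commute[of i "e - p"])
      then show ?thesis by (simp add: jm_simps)
    qed
    have "w \<in> I" using w by (simp add: I_def)
    then have p0: "p \<noteq> 0" using pI[of w] w(2) by (auto simp: jm_simps)
    have pc: "p \<odot> c = 0" if "c \<in> C" for c
    proof -
      have cW: "c \<in> W" using that CW by auto
      \<comment> \<open>\<open>s\<close> fixes \<open>p\<close> and annihilates \<open>c\<close>,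
        and multiplications by elements of \<open>W\<close> commute.\<close>
      have "p \<odot> c = c \<odot> (s \<odot> p)" using commute[of p c] pW(2) by simp
      also have "\<dots> = s \<odot> (p \<odot> c)" using comm[OF cW sW, of p] by (simp add: commute[of p c])
      also have "\<dots> = 0" using comm[OF sW pW(1), of c] by (simp add: sc[OF that] jm_simps)
      finally show ?thesis .
    qed
    have "p \<notin> C" using pc pI[OF p] p0 by auto
    have "idempotent_system (insert p C)"
      using C pI[OF p] p0 pc by (auto simp: idempotent_system_def) (metis commute pc)
    moreover have "P (insert p C)" using PC pW by (auto simp: P_def)
    ultimately show False using max[of "insert p C"] finC \<open>p \<notin> C\<close> by simp
  qed
  then have e: "\<Sum>C = e" by (simp add: s_def)
  have "x = (\<Sum>c\<in>C. x \<odot> c)" using jm_sum_right[of x "\<lambda>c. c" C] by (simp add: e)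
  also have "\<dots> \<in> span C"
  proof (rule span_sum)
    fix c assume "c \<in> C"
    then obtain \<mu> where "x \<odot> c = \<mu> *\<^sub>R c" using PC by (auto simp: P_def)
    then show "x \<odot> c \<in> span C" using \<open>c \<in> C\<close> by (simp add: span_base span_scale)
  qed
  finally show thesis using that C e by blast
qed

text \<open>Since \<open>t = t\<^sup>2 + 4 (t - t\<^sup>2)\<^sup>2\<close> on the possible eigenvalues 0, 1/2 and 1, multiplication by
  an idempotent is positive semidefinite.\<close>

lemma idempotent_quadratic_form:
  assumes "c \<odot> c = c"
  shows "B (c \<odot> x) x = B (c \<odot> x) (c \<odot> x) + 4 * B (c \<odot> x - c \<odot> (c \<odot> x)) (c \<odot> x - c \<odot> (c \<odot> x))"
  using arg_cong[OF peirce_polynomial[OF assms, of x], of "B x"]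
    arg_cong[OF peirce_polynomial[OF assms, of "c \<odot> x"], of "B x"]
  by (simp add: B_simps self_adjoint)

lemma idempotent_nonneg: "c \<odot> c = c \<Longrightarrow> B (c \<odot> x) x \<ge> 0"
  using idempotent_quadratic_form[of c x] B_nonneg[of "c \<odot> x"] B_nonneg[of "c \<odot> x - c \<odot> (c \<odot> x)"] by linarith

lemma idempotent_eq_0:
  assumes "c \<odot> c = c" "B (c \<odot> x) x = 0"
  shows "c \<odot> x = 0"
proof -
  have "B (c \<odot> x) (c \<odot> x) = 0"
    using idempotent_quadratic_form[OF assms(1), of x] assms(2)
      B_nonneg[of "c \<odot> x"] B_nonneg[of "c \<odot> x - c \<odot> (c \<odot> x)"] by linarith
  then show ?thesis by simp
qed

text \<open>The right side is the semidefinite form of \<open>c\<close> at \<open>d\<close>. This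
  transfers positivity to pairs of idempotents and makes \<open>B\<close>-orthogonality imply a zero
  product.\<close>

lemma idempotents_B:
  assumes "d \<odot> d = d"
  shows "B c d = B (c \<odot> d) d"
proof -
  have "B c d = B c (d \<odot> d)" by (simp add: assms)
  also have "\<dots> = B (d \<odot> c) d" by (simp add: self_adjoint)
  finally show ?thesis by (simp add: commute[of d c])
qed

lemma idempotents_B_nonneg: "c \<odot> c = c \<Longrightarrow> d \<odot> d = d \<Longrightarrow> B c d \<ge> 0"
  using idempotents_B[of d c] idempotent_nonneg[of c d] by simp

lemma idempotents_B_eq_0: "c \<odot> c = c \<Longrightarrow> d \<odot> d = d \<Longrightarrow> B c d = 0 \<Longrightarrow> c \<odot> d = 0"
  using idempotent_eq_0[of c d] idempotents_B[of d c] by simp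

lemma idempotent_complement: "c \<odot> c = c \<Longrightarrow> (e - c) \<odot> (e - c) = e - c"
  by (simp add: jm_simps)

text \<open>Expanding the square leaves twice \<open>a \<odot> b\<close>. Hence the summands that
  witness non-primitivity of an idempotent are automatically orthogonal.\<close>

lemma idempotent_sum_orthogonal:
  assumes "a \<odot> a = a" "b \<odot> b = b" "(a + b) \<odot> (a + b) = a + b"
  shows "a \<odot> b = 0"
proof -
  have "a \<odot> b + a \<odot> b = 0"
    using assms(3) commute[of b a] by (simp add: jm_simps assms(1,2) algebra_simps)
  then show ?thesis by (simp flip: scaleR_2)
qed

text \<open>\<open>B a d\<close> and \<open>B b d\<close> are nonnegative with sum 0. So splitting a
  member of a system preserves orthogonality to the others.\<close>

lemma orthogonal_summand:
  assumes "a \<odot> a = a" "b \<odot> b = b" "d \<odot> d = d" "(a + b) \<odot> d = 0"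
  shows "a \<odot> d = 0"
proof (rule idempotents_B_eq_0)
  have "B (a + b) d = 0"
    using assms(3,4) idempotents_B[of d "a + b"] by (simp add: B_simps)
  then show "B a d = 0"
    using idempotents_B_nonneg[of a d] idempotents_B_nonneg[of b d] assms by (simp add: B_simps)
qed (use assms in auto)

lemma jordan_frame_idempotent_system: "jordan_frame jm e C \<Longrightarrow> idempotent_system C"
  by (auto simp: jordan_frame_def idempotent_system_def primitive_idempotent_def idempotent_elem_def)

text \<open>Among the systems with sum \<open>e\<close> whose span contains \<open>x\<close>, a
  largest one is a frame: a member that is not primitive could be replaced by its two
  summands.\<close>

theorem spectral_decomposition:
  obtains C l where "jordan_frame jm e C" "x = (\<Sum>c\<in>C. l c *\<^sub>R c)"
proof -
  define P where "P C \<longleftrightarrow> \<Sum>C = e \<and> x \<in> span C" for C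
  obtain C where PC: "P C" and C: "idempotent_system C"
    and max: "\<And>D. P D \<Longrightarrow> idempotent_system D \<Longrightarrow> card D \<le> card C"
    using exists_maximal_idempotent_system[of P] exists_idempotent_eigensystem[of x]
    unfolding P_def by metis
  have finC: "finite C" using C by (simp add: idempotent_system_def)
  have "primitive_idempotent jm c" if c: "c \<in> C" for c
  proof (rule ccontr)
    assume "\<not> primitive_idempotent jm c"
    then obtain a b where ab: "a \<odot> a = a" "a \<noteq> 0" "b \<odot> b = b" "b \<noteq> 0" "c = a + b"
      using C c by (auto simp: primitive_idempotent_def idempotent_elem_def idempotent_system_def)
    have cc: "c \<odot> c = c" using C c by (simp add: idempotent_system_def)
    have o: "a \<odot> b = 0" using idempotent_sum_orthogonal[of a b] ab cc by simp
    have a: "a \<odot> d = 0" if "d \<in> C - {c}" for d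
      using orthogonal_summand[of a b d] ab that C c by (auto simp: idempotent_system_def)
    have b: "b \<odot> d = 0" if "d \<in> C - {c}" for d
      using orthogonal_summand[of b a d] ab that C c by (auto simp: idempotent_system_def add.commute)
    define D where "D = insert a (insert b (C - {c}))"
    \<comment> \<open>Otherwise \<open>a\<close> or \<open>b\<close> would be orthogonal to itself,
      although its square is itself and nonzero.\<close>
    have new: "a \<notin> C - {c}" "b \<notin> C - {c}" "a \<noteq> b" using a b o ab by auto
    have "\<forall>d\<in>C - {c}. a \<odot> d = 0 \<and> d \<odot> a = 0 \<and> b \<odot> d = 0 \<and> d \<odot> b = 0" "b \<odot> a = 0"
      using a b o by (simp_all add: commute[of _ a, THEN trans, OF a] commute[of _ b, THEN trans, OF b] commute[of b a])
    then have "idempotent_system D"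
      using C ab(1-4) o unfolding idempotent_system_def D_def by auto
    moreover have "P D"
    proof -
      have "\<Sum>D = \<Sum>C" using new finC c by (simp add: D_def ab(5) sum.remove[of C c] add.assoc)
      moreover have "C \<subseteq> span D"
      proof
        fix d assume "d \<in> C"
        have "a + b \<in> span D" unfolding D_def by (intro span_add span_base) auto
        then show "d \<in> span D"
          using \<open>d \<in> C\<close> ab(5) by (cases "d = c") (auto simp: D_def intro: span_base)
      qed
      then have "span C \<subseteq> span D" by (rule span_minimal) auto
      ultimately show ?thesis using PC by (auto simp: P_def)
    qed
    ultimately have "card D \<le> card C" by (rule max[rotated])
    moreover have "card D = Suc (card C)"
      using new finC card_Suc_Diff1[OF finC c] by (simp add: D_def del: card_Diff_insert)
    ultimately show False by simp
  qed
  then have "jordan_frame jm e C"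
    using PC C by (auto simp: jordan_frame_def idempotent_system_def P_def)
  moreover obtain l where "x = (\<Sum>c\<in>C. l c *\<^sub>R c)"
    using PC span_finite[OF finC] by (auto simp: P_def)
  ultimately show thesis using that by blast
qed

section \<open>Minimality of primitive idempotents\<close>

lemma primitive_idempotentD: "primitive_idempotent jm c \<Longrightarrow> c \<odot> c = c" "primitive_idempotent jm c \<Longrightarrow> c \<noteq> 0"
  by (auto simp: primitive_idempotent_def idempotent_elem_def)

text \<open>Orthogonality of \<open>p\<close> to \<open>e - c\<close> makes \<open>c - p\<close>
  idempotent, and primitivity of \<open>c\<close> rules out the splitting \<open>p + (c - p)\<close>
  unless \<open>c - p\<close> is 0.\<close>

lemma primitive_idempotent_minimal:
  assumes c: "primitive_idempotent jm c" and p: "p \<odot> p = p" "p \<noteq> 0" and "B p (e - c) = 0"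
  shows "p = c"
proof -
  note cc = primitive_idempotentD(1)[OF c]
  have "p \<odot> (e - c) = 0"
    using assms cc by (intro idempotents_B_eq_0 idempotent_complement)
  then have "p \<odot> c = p" "c \<odot> p = p" by (simp_all add: jm_simps commute[of c p])
  then have "(c - p) \<odot> (c - p) = c - p" using cc p by (simp add: jm_simps)
  moreover have "c = p + (c - p)" by simp
  ultimately show ?thesis
    using c p unfolding primitive_idempotent_def idempotent_elem_def by (metis right_minus_eq)
qed

text \<open>Squaring \<open>v\<close> makes its spectral coefficients nonnegative, so
  \<open>B (v \<odot> v) (e - c) = 0\<close> holds term by term. By minimality only \<open>c\<close>
  itself can carry a nonzero coefficient.\<close>

lemma primitive_peirce_space:
  assumes c: "primitive_idempotent jm c" and v: "c \<odot> v = v"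
  shows "v \<in> span {c}"
proof -
  obtain C l where C: "jordan_frame jm e C" and l: "v = (\<Sum>i\<in>C. l i *\<^sub>R i)"
    using spectral_decomposition .
  note C' = jordan_frame_idempotent_system[OF C]
  note cc = primitive_idempotentD(1)[OF c]
  have "B (v \<odot> v) (e - c) = 0"
    using v by (simp add: self_adjoint jm_simps B_simps commute[of v c])
  then have "(\<Sum>i\<in>C. (l i * l i) * B i (e - c)) = 0"
    unfolding l idempotent_system_mult[OF C'] by (simp add: B_sum_left bilinear_lmul[OF bilinear_B])
  moreover have "(l i * l i) * B i (e - c) \<ge> 0" if "i \<in> C" for i
    using that C' idempotents_B_nonneg[of i "e - c"] idempotent_complement[OF cc]
    by (simp add: idempotent_system_def)
  ultimately have z: "l i * l i * B i (e - c) = 0" if "i \<in> C" for i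
    using that C' sum_nonneg_eq_0_iff[of C "\<lambda>i. (l i * l i) * B i (e - c)"]
    by (simp add: idempotent_system_def)
  have "l i *\<^sub>R i \<in> span {c}" if "i \<in> C" for i
  proof (cases "l i = 0")
    case True
    then show ?thesis by (simp add: span_zero)
  next
    case False
    moreover have "i \<odot> i = i" "i \<noteq> 0" using C' that by (simp_all add: idempotent_system_def)
    ultimately have "i = c"
      using primitive_idempotent_minimal[OF c, of i] z[OF that] by simp
    then show ?thesis by (simp add: span_base span_scale)
  qed
  then show ?thesis unfolding l by (rule span_sum)
qed

section \<open>Primitive idempotents of a simple algebra\<close>

text \<open>With the quadratic map \<open>P(c) = 2 L(c)\<^sup>2 - L(c)\<close> one has \<open>P(c) d = \<mu> c\<close>.  The first factor is
  \<open>B (P(c) d) d\<close>, which is symmetric in \<open>c\<close> and \<open>d\<close> if both are idempotents.\<close>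

lemma primitive_quadratic_map:
  assumes c: "primitive_idempotent jm c"
  shows "(2 * B (c \<odot> d) (c \<odot> d) - B (c \<odot> d) d) * B c c = B c d * B c d"
proof -
  note cc = primitive_idempotentD(1)[OF c]
  define v where "v = 2 *\<^sub>R (c \<odot> (c \<odot> d)) - c \<odot> d"
  \<comment> \<open>\<open>2 t^2 - t\<close> is 0 at 0 and 1/2 and 1 at 1, so \<open>v\<close> is
    the component of \<open>d\<close> in the Peirce space of eigenvalue 1.\<close>
  have "c \<odot> v = v"
    using peirce_polynomial[OF cc, of d] by (simp add: v_def jm_simps algebra_simps scaleR_left_distrib[of 2 1, simplified])
  then obtain \<mu> where \<mu>: "v = \<mu> *\<^sub>R c"
    using primitive_peirce_space[OF c, of v] by (auto simp: span_singleton)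
  have "B v c = B c d" by (simp add: v_def B_simps self_adjoint cc B_sym[of d c])
  then have 1: "\<mu> * B c c = B c d" by (simp add: \<mu> B_simps)
  have "2 * B (c \<odot> d) (c \<odot> d) - B (c \<odot> d) d = B v d"
    by (simp add: v_def B_simps self_adjoint)
  also have "\<dots> = \<mu> * B c d" by (simp add: \<mu> B_simps)
  finally show ?thesis using 1 by (simp add: mult.assoc mult.commute mult.left_commute)
qed

text \<open>Exchanging \<open>c\<close> and \<open>d\<close> in the previous identity changes
  neither the factor \<open>k\<close> nor the right side; \<open>k\<close> cancels because the right
  side is nonzero.\<close>

lemma primitive_norm_eq_if_not_orthogonal:
  assumes c: "primitive_idempotent jm c" and d: "primitive_idempotent jm d" and "B c d \<noteq> 0"
  shows "B c c = B d d"
proof -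
  have *: "B (c \<odot> d) d = B c d" "B (c \<odot> d) c = B c d"
    using idempotents_B[of d c] idempotents_B[of c d] primitive_idempotentD(1)[OF c] primitive_idempotentD(1)[OF d]
    by (simp_all add: commute[of d c] B_sym[of d c])
  define k where "k = 2 * B (c \<odot> d) (c \<odot> d) - B c d"
  have "k * B c c = B c d * B c d"
    using primitive_quadratic_map[OF c, of d] by (simp add: * k_def)
  moreover have "k * B d d = B c d * B c d"
    using primitive_quadratic_map[OF d, of c] by (simp add: * k_def B_sym[of d c] commute[of d c])
  ultimately show ?thesis using assms(3) by (metis mult_cancel_left mult_eq_0_iff)
qed

text \<open>If the norms differed, the ideal \<open>span G\<close> would be the whole space, yet
  \<open>d\<close> is orthogonal to it and hence to itself.\<close>

lemma primitive_norm_eq: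
  assumes simple: "\<And>I. jordan_ideal jm I \<Longrightarrow> I = {0} \<or> I = UNIV"
    and c: "primitive_idempotent jm c" and d: "primitive_idempotent jm d"
  shows "B c c = B d d"
proof (rule ccontr)
  assume ne: "B c c \<noteq> B d d"
  define G where "G = {p. primitive_idempotent jm p \<and> B p p = B c c}"
  have orth: "B p q = 0" if "p \<in> G" "primitive_idempotent jm q" "q \<notin> G" for p q
    using primitive_norm_eq_if_not_orthogonal[of p q] that by (auto simp: G_def)
  have orth_jm: "q \<odot> p = 0" if "p \<in> G" "primitive_idempotent jm q" "q \<notin> G" for p q
    using orth[OF that] that primitive_idempotentD(1)
    by (intro idempotents_B_eq_0) (auto simp: G_def B_sym)
  \<comment> \<open>A spectral component \<open>k\<close> of \<open>i \<odot> p\<close> outside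
    \<open>G\<close> has coefficient 0, since \<open>B (i \<odot> p) k = B p (i \<odot> k)\<close>
    and \<open>i \<odot> k = 0\<close>.\<close>
  have prod: "i \<odot> p \<in> span G" if i: "i \<in> G" and p: "p \<in> G" for i p
  proof -
    obtain C l where C: "jordan_frame jm e C" and l: "i \<odot> p = (\<Sum>k\<in>C. l k *\<^sub>R k)"
      using spectral_decomposition .
    have "l k *\<^sub>R k \<in> span G" if k: "k \<in> C" for k
    proof (cases "k \<in> G")
      case True
      then show ?thesis by (simp add: span_base span_scale)
    next
      case False
      have pk: "primitive_idempotent jm k" using C k by (simp add: jordan_frame_def)
      have "l k * B k k = B (i \<odot> p) k"
        using idempotent_system_B[OF jordan_frame_idempotent_system[OF C] k, of l] l by simp
      also have "\<dots> = 0" using orth_jm[OF i pk False] by (simp add: self_adjoint commute[of i k] B_simps)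
      finally show ?thesis using primitive_idempotentD(2)[OF pk] by (simp add: span_zero)
    qed
    then show ?thesis unfolding l by (rule span_sum)
  qed
  have "x \<odot> y \<in> span G" if "y \<in> span G" for x y
    using that
  proof (induction y rule: span_induct)
    case base
    show ?case by (auto simp: subspace_def jm_simps intro: span_zero span_add span_scale)
  next
    case (step p)
    obtain C l where C: "jordan_frame jm e C" and l: "x = (\<Sum>i\<in>C. l i *\<^sub>R i)"
      using spectral_decomposition .
    have "(l i *\<^sub>R i) \<odot> p \<in> span G" if "i \<in> C" for i
      using prod[of i p] orth_jm[of p i] C that step
      by (cases "i \<in> G") (auto simp: jordan_frame_def jm_simps span_scale span_zero)
    then show ?case unfolding l jm_sum_left by (rule span_sum)
  qed
  then have "jordan_ideal jm (span G)" by (simp add: jordan_ideal_def)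
  moreover have "c \<in> span G" "c \<noteq> 0"
    using c primitive_idempotentD(2) by (auto simp: G_def intro: span_base)
  ultimately have "d \<in> span G" using simple by blast
  moreover have "B y d = 0" if "y \<in> span G" for y
    using that
  proof (induction rule: span_induct)
    case base
    show ?case by (auto simp: subspace_def B_simps)
  next
    case (step p)
    then show ?case using orth[of p d] d ne by (auto simp: G_def)
  qed
  ultimately show False using primitive_idempotentD(2)[OF d] B_eq_0 by blast
qed


lemma unit_neq_0: "e \<noteq> 0"
proof
  assume "e = 0"
  then have "x = 0" for x :: 'a using unit_left[of x] by (simp add: jm_simps)
  moreover obtain b :: 'a where "b \<in> Basis" using nonempty_Basis by blast
  ultimately show False using nonzero_Basis by metis
qed

lemma exists_primitive_idempotent: "\<exists>c. primitive_idempotent jm c"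
proof -
  obtain C l where "jordan_frame jm e C" "e = (\<Sum>c\<in>C. l c *\<^sub>R c)"
    using spectral_decomposition .
  then show ?thesis using unit_neq_0 by (cases "C = {}") (auto simp: jordan_frame_def)
qed

section \<open>Extreme rays of the cone of squares\<close>

lemma in_cone_of_squares:
  assumes C: "jordan_frame jm e C" and l: "\<And>c. c \<in> C \<Longrightarrow> l c \<ge> 0"
  shows "(\<Sum>c\<in>C. l c *\<^sub>R c) \<in> cone_of_squares jm"
proof -
  have "(\<Sum>c\<in>C. l c *\<^sub>R c) = (\<Sum>c\<in>C. sqrt (l c) *\<^sub>R c) \<odot> (\<Sum>c\<in>C. sqrt (l c) *\<^sub>R c)"
    unfolding idempotent_system_mult[OF jordan_frame_idempotent_system[OF C]] by (simp add: l)
  then show ?thesis by (auto simp: cone_of_squares_def)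
qed

lemma cone_of_squares_spectral:
  assumes "x \<in> cone_of_squares jm"
  obtains C l where "jordan_frame jm e C" "\<And>c. c \<in> C \<Longrightarrow> l c \<ge> 0" "x = (\<Sum>c\<in>C. l c *\<^sub>R c)"
proof -
  obtain y where y: "x = y \<odot> y" using assms by (auto simp: cone_of_squares_def)
  obtain C l where C: "jordan_frame jm e C" and l: "y = (\<Sum>c\<in>C. l c *\<^sub>R c)"
    using spectral_decomposition .
  have "x = (\<Sum>c\<in>C. (l c * l c) *\<^sub>R c)"
    unfolding y l by (rule idempotent_system_mult[OF jordan_frame_idempotent_system[OF C]])
  then show thesis using that[of C "\<lambda>c. l c * l c"] C by simp
qed

lemma cone_B_idempotent_nonneg:
  assumes "x \<in> cone_of_squares jm" "p \<odot> p = p"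
  shows "B x p \<ge> 0"
proof -
  obtain y where "x = y \<odot> y" using assms by (auto simp: cone_of_squares_def)
  then show ?thesis
    using idempotent_nonneg[OF assms(2), of y] by (simp add: self_adjoint commute[of y p] B_sym[of "p \<odot> y" y])
qed

text \<open>As in \<open>primitive_peirce_space\<close>, a sum of nonnegative terms vanishes; here
  the spectral coefficients are nonnegative because \<open>x\<close> lies in the cone.\<close>

lemma cone_orthogonal_complement:
  assumes x: "x \<in> cone_of_squares jm" and c: "primitive_idempotent jm c" and "B x (e - c) = 0"
  shows "x \<in> ray c"
proof -
  obtain C l where C: "jordan_frame jm e C" and l: "\<And>i. i \<in> C \<Longrightarrow> l i \<ge> 0" "x = (\<Sum>i\<in>C. l i *\<^sub>R i)"
    by (rule cone_of_squares_spectral[OF x]) (rule that)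
  have finC: "finite C" using C by (simp add: jordan_frame_def)
  have idem: "i \<odot> i = i" "i \<noteq> 0" if "i \<in> C" for i
    using C that primitive_idempotentD by (auto simp: jordan_frame_def)
  have "(\<Sum>i\<in>C. l i * B i (e - c)) = 0"
    using assms(3) unfolding l by (simp add: B_sum_left bilinear_lmul[OF bilinear_B])
  moreover have "l i * B i (e - c) \<ge> 0" if "i \<in> C" for i
    using l(1)[OF that] idempotents_B_nonneg[OF idem(1)[OF that] idempotent_complement[OF primitive_idempotentD(1)[OF c]]]
    by (rule mult_nonneg_nonneg)
  ultimately have z: "l i * B i (e - c) = 0" if "i \<in> C" for i
    using that sum_nonneg_eq_0_iff[OF finC, of "\<lambda>i. l i * B i (e - c)"] by blast
  \<comment> \<open>\<open>c\<close> may lie outside \<open>C\<close>; then every coefficient is 0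
    and \<open>x = 0\<close>, which is still on the ray.\<close>
  have "l i *\<^sub>R i = (if i = c then l c else 0) *\<^sub>R c" if "i \<in> C" for i
    using z[OF that] primitive_idempotent_minimal[OF c idem[OF that]] by auto
  then have "x = (\<Sum>i\<in>C. (if i = c then l c else 0) *\<^sub>R c)"
    unfolding l(2) by (rule sum.cong[OF refl])
  also have "\<dots> = (\<Sum>i\<in>C. if i = c then l c else 0) *\<^sub>R c"
    by (rule scaleR_left.sum[symmetric])
  finally have "x = (\<Sum>i\<in>C. if i = c then l c else 0) *\<^sub>R c" .
  moreover have "(\<Sum>i\<in>C. if i = c then l c else 0) \<ge> 0"
    using l(1) by (intro sum_nonneg) auto
  ultimately show ?thesis by (auto simp: ray_def)
qed

lemma convex_ray: "convex (ray u)"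
proof -
  have "ray u = (\<lambda>t. t *\<^sub>R u) ` {0..}" by (auto simp: ray_def)
  then show ?thesis
    using convex_linear_image[of "\<lambda>t. t *\<^sub>R u" "{0..}"] by (simp add: linear_scaleR_left)
qed

text \<open>Pairing with \<open>e - c\<close> exposes the ray: it is nonnegative on the cone and
  zero on \<open>ray c\<close>, so it vanishes at both ends of a segment whose interior meets the
  ray.\<close>

lemma primitive_idempotent_extreme_ray:
  assumes c: "primitive_idempotent jm c"
  shows "ray c extreme_ray_of cone_of_squares jm"
proof -
  note cc = primitive_idempotentD[OF c]
  have "ray c \<subseteq> cone_of_squares jm"
  proof
    fix x assume "x \<in> ray c"
    then obtain t where t: "t \<ge> 0" "x = t *\<^sub>R c" by (auto simp: ray_def)
    then have "x = (sqrt t *\<^sub>R c) \<odot> (sqrt t *\<^sub>R c)" by (simp add: jm_simps cc)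
    then show "x \<in> cone_of_squares jm" by (auto simp: cone_of_squares_def)
  qed
  moreover have "a \<in> ray c \<and> b \<in> ray c"
    if a: "a \<in> cone_of_squares jm" and b: "b \<in> cone_of_squares jm" and "x \<in> ray c" "x \<in> open_segment a b" for a b x
  proof -
    obtain t where t: "x = t *\<^sub>R c" using \<open>x \<in> ray c\<close> by (auto simp: ray_def)
    obtain u where u: "0 < u" "u < 1" "x = (1 - u) *\<^sub>R a + u *\<^sub>R b"
      using \<open>x \<in> open_segment a b\<close> by (auto simp: in_segment)
    have "B x (e - c) = 0"
      using idempotents_B[OF cc(1), of e] by (simp add: t B_simps B_sym[of c e])
    then have s: "(1 - u) * B a (e - c) + u * B b (e - c) = 0"
      by (simp add: u bilinear_ladd[OF bilinear_B] bilinear_lmul[OF bilinear_B])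
    have nn: "B a (e - c) \<ge> 0" "B b (e - c) \<ge> 0"
      using cone_B_idempotent_nonneg[OF a] cone_B_idempotent_nonneg[OF b] idempotent_complement[OF cc(1)] by auto
    then have "(1 - u) * B a (e - c) \<ge> 0" "u * B b (e - c) \<ge> 0" using u by auto
    then have "(1 - u) * B a (e - c) = 0" "u * B b (e - c) = 0" using s by linarith+
    then show ?thesis using u cone_orthogonal_complement[OF a c] cone_orthogonal_complement[OF b c] by simp
  qed
  ultimately show ?thesis
    using cc(2) convex_ray unfolding extreme_ray_of_def face_of_def by blast
qed

text \<open>Any spectral term of \<open>u\<close> with a nonzero coefficient must lie on the ray of
  \<open>u\<close>, so \<open>u\<close> is a positive multiple of that idempotent.\<close>

lemma extreme_ray_primitive_idempotent:
  assumes "ray u extreme_ray_of cone_of_squares jm" "u \<noteq> 0"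
  obtains c s where "primitive_idempotent jm c" "s > 0" "u = s *\<^sub>R c"
proof -
  let ?K = "cone_of_squares jm"
  have face: "ray u face_of ?K" using assms by (simp add: extreme_ray_of_def)
  have uray: "u \<in> ray u" by (auto simp: ray_def intro: exI[of _ 1])
  then have uK: "u \<in> ?K" using face face_of_imp_subset by blast
  obtain C l where C: "jordan_frame jm e C" and l: "\<And>c. c \<in> C \<Longrightarrow> l c \<ge> 0" "u = (\<Sum>c\<in>C. l c *\<^sub>R c)"
    by (rule cone_of_squares_spectral[OF uK]) (rule that)
  have finC: "finite C" using C by (simp add: jordan_frame_def)
  obtain c where c: "c \<in> C" "l c \<noteq> 0"
    using assms(2) l(2) by (metis (no_types, lifting) scale_eq_0_iff sum.neutral)
  have lc: "l c > 0" using l(1)[OF c(1)] c(2) by simp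
  have pc: "primitive_idempotent jm c" using C c by (simp add: jordan_frame_def)
  \<comment> \<open>\<open>u\<close> is the midpoint of \<open>a\<close> and \<open>b\<close>, so the face property puts \<open>a\<close> on the ray of \<open>u\<close>.\<close>
  define a where "a = 2 *\<^sub>R (l c *\<^sub>R c)"
  define b where "b = 2 *\<^sub>R (u - l c *\<^sub>R c)"
  have "a = (\<Sum>i\<in>C. (if i = c then 2 * l c else 0) *\<^sub>R i)"
    using finC c by (simp add: a_def if_distrib[of "\<lambda>t. t *\<^sub>R _"] cong: if_cong)
  then have aK: "a \<in> ?K" using in_cone_of_squares[OF C] lc by simp
  have "b = (\<Sum>i\<in>C. (if i = c then 0 else 2 * l i) *\<^sub>R i)"
    unfolding b_def l(2) by (simp add: sum.remove[OF finC c(1)] scaleR_right.sum)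
  then have bK: "b \<in> ?K" using in_cone_of_squares[OF C] l(1) by simp
  have u: "u = midpoint a b" by (simp add: midpoint_def a_def b_def algebra_simps)
  have "a \<in> ray u"
  \<comment> \<open>If \<open>a = b\<close> the open segment is empty, but then \<open>a\<close> is
    \<open>u\<close>.\<close>
  proof (cases "a = b")
    case True
    then show ?thesis using uray u by simp
  next
    case False
    then have "u \<in> open_segment a b" using u by simp
    then show ?thesis using face aK bK uray unfolding face_of_def by blast
  qed
  then obtain t where t: "t \<ge> 0" "a = t *\<^sub>R u" by (auto simp: ray_def)
  have "a \<noteq> 0" using lc primitive_idempotentD(2)[OF pc] by (simp add: a_def)
  then have "t > 0" using t by (cases "t = 0") auto
  then have "u = (1 / t) *\<^sub>R a"
    by (simp add: t(2))
  then have "u = (2 * l c / t) *\<^sub>R c"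
    by (simp add: a_def)
  then show thesis using that[OF pc, of "2 * l c / t"] lc \<open>t > 0\<close> by simp
qed

end

section \<open>The Jordan trace and the affine hull of the extreme generators\<close>

text \<open>This is the scaling for which \<open>B\<close> becomes the trace inner product.\<close>

locale trace_normalized_jordan = euclidean_jordan +
  assumes primitive_norm: "primitive_idempotent jm c \<Longrightarrow> B c c = 1"
begin

lemma B_primitive_unit: "primitive_idempotent jm c \<Longrightarrow> B c e = 1"
  using primitive_norm[of c] self_adjoint[of c c e] primitive_idempotentD(1)[of c] by simp

text \<open>The linear functional \<open>B _ e\<close> is 1 on each primitive idempotent, so it
  returns the eigenvalue sum of every decomposition; this gives the uniqueness behind
  \<open>THE\<close>.\<close>

lemma jordan_trace_eq: "jordan_trace jm e x = B x e"
proof -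
  have *: "B (\<Sum>c\<in>C. l c *\<^sub>R c) e = (\<Sum>c\<in>C. l c)" if "jordan_frame jm e C" for C l
    using that B_primitive_unit
    by (auto simp: B_sum_left bilinear_lmul[OF bilinear_B] jordan_frame_def intro!: sum.cong)
  obtain C l where C: "jordan_frame jm e C" "x = (\<Sum>c\<in>C. l c *\<^sub>R c)"
    using spectral_decomposition .
  show ?thesis
    unfolding jordan_trace_def
  proof (rule the_equality)
    show "\<exists>C l. jordan_frame jm e C \<and> x = (\<Sum>c\<in>C. l c *\<^sub>R c) \<and> B x e = (\<Sum>c\<in>C. l c)"
      using C * by blast
    show "t = B x e" if "\<exists>C l. jordan_frame jm e C \<and> x = (\<Sum>c\<in>C. l c *\<^sub>R c) \<and> t = (\<Sum>c\<in>C. l c)" for t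
      using that by (elim exE conjE) (simp add: *)
  qed
qed

lemma trace_inner_eq: "trace_inner jm e x y = B x y"
  by (simp add: trace_inner_def jordan_trace_eq self_adjoint B_sym[of y x])

lemma trace_norm_eq: "trace_norm jm e x = sqrt (B x x)"
  by (simp add: trace_norm_def trace_inner_eq)

text \<open>Each member of a frame contributes 1 to \<open>B e e\<close>, so all frames have the
  same size and \<open>jordan_rank\<close> is well defined.\<close>

lemma jordan_frame_card: "jordan_frame jm e C \<Longrightarrow> real (card C) = B e e"
  using B_sum_left[of "\<lambda>c. c" C e] B_primitive_unit by (simp add: jordan_frame_def)

lemma exists_jordan_frame_card:
  obtains C where "jordan_frame jm e C" "card C = jordan_rank jm e"
proof -
  obtain C l where C: "jordan_frame jm e C" "e = (\<Sum>c\<in>C. l c *\<^sub>R c)"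
    using spectral_decomposition .
  then have "jordan_rank jm e = card C"
    unfolding jordan_rank_def using jordan_frame_card
    by (intro the_equality) (auto, metis of_nat_eq_iff)
  then show thesis using that C by simp
qed

lemma unit_extreme_generators_eq: "unit_extreme_generators jm e = {c. primitive_idempotent jm c}"
proof (intro set_eqI iffI)
  fix u assume "u \<in> unit_extreme_generators jm e"
  then have u: "sqrt (B u u) = 1" "ray u extreme_ray_of cone_of_squares jm"
    by (simp_all add: unit_extreme_generators_def trace_norm_eq)
  then have "u \<noteq> 0" by (auto simp: B_simps)
  then obtain c s where c: "primitive_idempotent jm c" "s > 0" "u = s *\<^sub>R c"
    using extreme_ray_primitive_idempotent u(2) by metis
  then have "s * s = 1" using u(1) primitive_norm[OF c(1)] by (simp add: B_simps)
  then have "s = 1" using c(2) by (simp add: square_eq_1_iff)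
  then show "u \<in> {c. primitive_idempotent jm c}" using c by simp
next
  fix c assume "c \<in> {c. primitive_idempotent jm c}"
  then show "c \<in> unit_extreme_generators jm e"
    using primitive_norm primitive_idempotent_extreme_ray
    by (simp add: unit_extreme_generators_def trace_norm_eq)
qed

lemma closure_affine_hull_primitive_trace:
  "closure (affine hull {c. primitive_idempotent jm c}) \<subseteq> {x. B x e = 1}"
proof (rule closure_minimal)
  have "affine {x. B x e = 1}"
    by (auto simp: affine_def B_simps simp flip: distrib_right)
  then show "affine hull {c. primitive_idempotent jm c} \<subseteq> {x. B x e = 1}"
    using B_primitive_unit by (intro hull_minimal) auto
  have "continuous_on UNIV (B e)"
    using linear_B linear_continuous_on linear_conv_bounded_linear by blast
  then have "closed {x. B e x = 1}"
    by (intro closed_Collect_eq continuous_on_const)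
  then show "closed {x. B x e = 1}" by (simp add: B_sym[of _ e])
qed

lemma projection_of_0:
  defines "r \<equiv> jordan_rank jm e"
  shows "trace_proj jm e (closure (affine hull {c. primitive_idempotent jm c})) 0 = (1 / real r) *\<^sub>R e"
    and "B ((1 / real r) *\<^sub>R e) ((1 / real r) *\<^sub>R e) = 1 / real r"
proof -
  let ?S = "closure (affine hull {c. primitive_idempotent jm c})"
  let ?p = "(1 / real r) *\<^sub>R e"
  obtain C where C: "jordan_frame jm e C" "card C = r"
    using exists_jordan_frame_card unfolding r_def by metis
  have Bee: "B e e = real r" using jordan_frame_card[OF C(1)] C(2) by simp
  then have r: "real r > 0" using B_pos[OF unit_neq_0] by simp
  show Bpp: "B ?p ?p = 1 / real r" using r by (simp add: B_simps Bee)
  have "?p = (\<Sum>c\<in>C. (1 / real r) *\<^sub>R c)"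
    using C by (simp add: jordan_frame_def flip: scaleR_right.sum)
  also have "\<dots> \<in> affine hull C"
    using C r by (auto simp: affine_hull_finite jordan_frame_def intro!: exI[of _ "\<lambda>_. 1 / real r"])
  also have "\<dots> \<subseteq> affine hull {c. primitive_idempotent jm c}"
    using C by (intro hull_mono) (auto simp: jordan_frame_def)
  also have "\<dots> \<subseteq> ?S" by (rule closure_subset)
  finally have pS: "?p \<in> ?S" .
  \<comment> \<open>\<open>B z e = 1\<close> makes \<open>z - ?p\<close> orthogonal to
    \<open>?p\<close>. Pythagoras then gives both minimality and uniqueness of the nearest
    point.\<close>
  have pyth: "B z z = B ?p ?p + B (z - ?p) (z - ?p)" if "z \<in> ?S" for z
  proof -
    have "B z e = 1" using that closure_affine_hull_primitive_trace by auto
    then have "B z ?p = B ?p ?p" using Bpp by (simp add: bilinear_rmul[OF bilinear_B])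
    then show ?thesis
      by (simp add: bilinear_lsub[OF bilinear_B] bilinear_rsub[OF bilinear_B] B_sym[of ?p z])
  qed
  have norm0: "trace_norm jm e (0 - z) = sqrt (B z z)" for z
    by (simp add: trace_norm_eq B_simps)
  show "trace_proj jm e ?S 0 = ?p"
    unfolding trace_proj_def
  proof (rule the_equality, intro conjI ballI)
    show "trace_norm jm e (0 - ?p) \<le> trace_norm jm e (0 - z)" if "z \<in> ?S" for z
      using pyth[OF that] B_nonneg[of "z - ?p"] unfolding norm0 by simp
  next
    fix y assume y: "y \<in> ?S \<and> (\<forall>z\<in>?S. trace_norm jm e (0 - y) \<le> trace_norm jm e (0 - z))"
    then have "trace_norm jm e (0 - y) \<le> trace_norm jm e (0 - ?p)" using pS by blast
    then have "B y y \<le> B ?p ?p" unfolding norm0 by simp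
    then have "B (y - ?p) (y - ?p) = 0"
      using pyth[of y] y B_nonneg[of "y - ?p"] by simp
    then show "y = ?p" by simp
  qed (rule pS)
qed

end

section \<open>Normalization of the form and conclusion\<close>

lemma simple_trace_normalized:
  assumes "simple_euclidean_jordan_algebra jm e"
  obtains B where "trace_normalized_jordan jm e B"
proof -
  have alg: "bilinear jm" "\<And>x y. jm x y = jm y x" "\<And>x. jm e x = x"
    "\<And>x y. jm x (jm (jm x x) y) = jm (jm x x) (jm x y)"
    and simple: "\<And>I. jordan_ideal jm I \<Longrightarrow> I = {0} \<or> I = UNIV"
    using assms by (auto simp: simple_euclidean_jordan_algebra_def euclidean_jordan_algebra_def)
  obtain B where B: "is_inner_product B" "\<And>x y z. B (jm x y) z = B y (jm x z)"
    using assms by (auto simp: simple_euclidean_jordan_algebra_def euclidean_jordan_algebra_def)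
  interpret euclidean_jordan jm e B
    by unfold_locales (fact alg B)+
  obtain c where c: "primitive_idempotent jm c" using exists_primitive_idempotent by blast
  \<comment> \<open>By simplicity \<open>B p p = k\<close> for every primitive idempotent
    \<open>p\<close>, so dividing \<open>B\<close> by \<open>k\<close> gives the required
    scaling.\<close>
  define k where "k = B c c"
  have k: "k > 0" using B_pos primitive_idempotentD(2)[OF c] by (simp add: k_def)
  have inner: "is_inner_product (\<lambda>x y. B x y / k)"
    using B_pos k B_sym unfolding is_inner_product_def bilinear_def
    by (auto simp: linear_iff B_simps add_divide_distrib)
  have norm: "B p p / k = 1" if "primitive_idempotent jm p" for p
    using primitive_norm_eq[OF simple that c] primitive_idempotentD(2)[OF c] by (simp add: k_def)
  have "trace_normalized_jordan jm e (\<lambda>x y. B x y / k)"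
    by unfold_locales (fact alg inner norm | simp add: B(2))+
  then show thesis by (rule that)
qed

theorem proposition6p9:
  fixes jm :: "'a::euclidean_space \<Rightarrow> 'a \<Rightarrow> 'a" and e d :: 'a and r :: nat and E :: "'a set"
  assumes simple: "simple_euclidean_jordan_algebra jm e"
    and rank: "r = jordan_rank jm e"
    and E: "E = unit_extreme_generators jm e"
    and d: "d = - trace_proj jm e (closure (affine hull E)) 0"
  shows "E = {c. primitive_idempotent jm c}
    \<and> (E \<subseteq> {x. jordan_trace jm e x = 1} \<and> 0 \<notin> affine hull E \<and> 0 \<notin> closure (affine hull E))
    \<and> (d = - ((1 / real r) *\<^sub>R e) \<and> (trace_norm jm e d)\<^sup>2 = 1 / real r)"
proof -
  obtain B where "trace_normalized_jordan jm e B"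
    using simple_trace_normalized[OF simple] .
  then interpret trace_normalized_jordan jm e B .
  have E': "E = {c. primitive_idempotent jm c}" by (simp add: E unit_extreme_generators_eq)
  have n0: "0 \<notin> closure (affine hull E)"
    using closure_affine_hull_primitive_trace unfolding E' by (auto simp: B_simps)
  then have "0 \<notin> affine hull E" using closure_subset by blast
  moreover have d': "d = - ((1 / real r) *\<^sub>R e)"
    unfolding d E' rank projection_of_0(1) ..
  moreover have "(trace_norm jm e d)\<^sup>2 = B d d" by (simp add: trace_norm_eq B_nonneg)
  moreover have "B d d = 1 / real r"
    using projection_of_0(2) by (simp add: d' rank bilinear_lneg[OF bilinear_B] bilinear_rneg[OF bilinear_B])
  ultimately show ?thesis using E' n0 B_primitive_unit by (auto simp: jordan_trace_eq)
qed

end
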